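(* Let $M$ be a complex unital Jordan--Banach algebra and let $\varphi:M\to\mathbb{C}$ be a non-zero real-linear functional. Suppose that $\varphi(a)\in\mathrm{Sp}_{exp}(a)$ for all $a\in M$. Then $\varphi$ is complex linear and (Jordan-)multiplicative, that is, $\varphi(a\circ b)=\varphi(a)\varphi(b)$ for all $a,b\in M$.
   Context: A complex Jordan algebra is a complex vector space $M$ with a commutative bilinear product $\circ$ satisfying $(a\circ b)\circ a^2=a\circ(b\circ a^2)$. A Jordan--Banach algebra is a Jordan algebra with a complete norm satisfying $\|a\circ b\|\le\|a\|\,\|b\|$; if it is unital one also requires $\|\mathbf{1}_M\|=1$. An element $a\in M$ is invertible if there is a (necessarily unique) $b\in M$ with $a\circ b=\mathbf{1}_M$ and $a^2\circ b=a$; $M^{-1}$ is the (open) set of invertible elements, and $M^{-1}_{\mathbf{1}}$ denotes the connected component of $M^{-1}$ containing $\mathbf{1}_M$ (the principal component). The exponential spectrum of $a\in M$ is $\mathrm{Sp}_{exp}(a)=\{\lambda\in\mathbb{C}: a-\lambda\mathbf{1}_M\notin M^{-1}_{\mathbf{1}}\}$. *)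

theory Defs
  imports "HOL-Analysis.Analysis"
begin

locale complex_jordan_algebra = vector_space scaleC
  for scaleC :: "complex \<Rightarrow> 'a::ab_group_add \<Rightarrow> 'a" (infixr "*\<^sub>C" 75) +
  fixes jprod :: "'a \<Rightarrow> 'a \<Rightarrow> 'a" (infixl "\<bullet>\<^sub>J" 70)
  assumes jprod_commute: "a \<bullet>\<^sub>J b = b \<bullet>\<^sub>J a"
    and jprod_linear_left: "Vector_Spaces.linear scaleC scaleC (\<lambda>a. a \<bullet>\<^sub>J b)"
    and jprod_linear_right: "Vector_Spaces.linear scaleC scaleC (\<lambda>b. a \<bullet>\<^sub>J b)"
    and jordan_identity:
      "(a \<bullet>\<^sub>J b) \<bullet>\<^sub>J (a \<bullet>\<^sub>J a) = a \<bullet>\<^sub>J (b \<bullet>\<^sub>J (a \<bullet>\<^sub>J a))"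

text \<open>HOL-Analysis has no class of complex normed spaces. The class \<^class>\<open>banach\<close> supplies the
  complete norm and the underlying real scalar multiplication; \<open>scaleR_scaleC\<close> and \<open>norm_scaleC\<close>
  turn the type into a complex Banach space with scalar multiplication \<open>scaleC\<close>.\<close>

locale complex_jordan_banach_algebra = complex_jordan_algebra scaleC jprod
  for scaleC :: "complex \<Rightarrow> 'a::banach \<Rightarrow> 'a" (infixr "*\<^sub>C" 75)
    and jprod :: "'a \<Rightarrow> 'a \<Rightarrow> 'a" (infixl "\<bullet>\<^sub>J" 70) +
  assumes scaleR_scaleC: "r *\<^sub>R a = complex_of_real r *\<^sub>C a"
    and norm_scaleC: "norm (c *\<^sub>C a) = cmod c * norm a"
    and norm_jprod: "norm (a \<bullet>\<^sub>J b) \<le> norm a * norm b"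

locale complex_unital_jordan_banach_algebra = complex_jordan_banach_algebra scaleC jprod
  for scaleC :: "complex \<Rightarrow> 'a::banach \<Rightarrow> 'a" (infixr "*\<^sub>C" 75)
    and jprod :: "'a \<Rightarrow> 'a \<Rightarrow> 'a" (infixl "\<bullet>\<^sub>J" 70) +
  fixes unit :: 'a
  assumes unit_jprod: "unit \<bullet>\<^sub>J a = a"
    and norm_unit: "norm unit = 1"

definition jordan_invertibles :: "('a \<Rightarrow> 'a \<Rightarrow> 'a) \<Rightarrow> 'a \<Rightarrow> 'a set" where
  "jordan_invertibles jprod unit =
     {a. \<exists>b. jprod a b = unit \<and> jprod (jprod a a) b = a}"

definition principal_component ::
    "('a::topological_space \<Rightarrow> 'a \<Rightarrow> 'a) \<Rightarrow> 'a \<Rightarrow> 'a set" where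
  "principal_component jprod unit =
     connected_component_set (jordan_invertibles jprod unit) unit"

definition exponential_spectrum ::
    "(complex \<Rightarrow> 'a \<Rightarrow> 'a) \<Rightarrow> ('a \<Rightarrow> 'a \<Rightarrow> 'a) \<Rightarrow> 'a \<Rightarrow> 'a::banach \<Rightarrow> complex set" where
  "exponential_spectrum scaleC jprod unit a =
     {z. a - scaleC z unit \<notin> principal_component jprod unit}"

end

theory Submission
  imports Defs "HOL-Computational_Algebra.Fundamental_Theorem_Algebra"
begin

text \<open>Since 0 is not in the exponential spectrum of an element of the principal component,
  \<open>\<phi>\<close> has no zero there. Let \<open>\<psi>\<^sub>1\<close> and \<open>\<psi>\<^sub>2\<close> be the complex linear functionals with
  \<open>Re \<psi>\<^sub>1 = Re \<phi>\<close> and \<open>Im \<psi>\<^sub>2 = Im \<phi>\<close>. If \<open>\<psi>\<^sub>1 x = 0\<close> for a principal \<open>x\<close>, then \<open>\<phi> (c x) = 0\<close> for a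
  suitable scalar \<open>c \<noteq> 0\<close>, which is absurd; likewise for \<open>\<psi>\<^sub>2\<close>. So both are non-zero on the principal
  component, in particular on \<open>(1 - w a)\<^sup>n\<close> for \<open>\<bar>w\<bar> \<parallel>a\<parallel> < 1\<close>, which is invertible already in the
  closed subalgebra generated by \<open>a\<close>, associative because the \<open>a\<^sup>k\<close> operator commute. The reciprocals of the roots of the
  polynomial \<open>\<psi> ((1 - w a)\<^sup>n)\<close> in \<open>w\<close> are therefore bounded by \<open>\<parallel>a\<parallel>\<close>; the sum of their squares is
  \<open>n\<^sup>2 (\<psi> a)\<^sup>2 - n (n - 1) \<psi> (a\<^sup>2)\<close> and at most \<open>n \<parallel>a\<parallel>\<^sup>2\<close> in modulus, and \<open>n \<rightarrow> \<infinity>\<close> gives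
  \<open>\<psi> (a\<^sup>2) = (\<psi> a)\<^sup>2\<close>. If the characters \<open>\<psi>\<^sub>1\<close>, \<open>\<psi>\<^sub>2\<close> were distinct, some principal \<open>b\<close> would satisfy
  \<open>\<psi>\<^sub>1 b = \<i>\<close>, \<open>\<psi>\<^sub>2 b = 1\<close>, that is \<open>\<phi> b = 0\<close>. Hence \<open>\<phi> = \<psi>\<^sub>1 = \<psi>\<^sub>2\<close>.\<close>

section \<open>Preliminaries on closures, complex polynomials and roots of the imaginary
  unit\<close>

lemma closure_closed_under:
  fixes f :: "'a::topological_space \<Rightarrow> 'a \<Rightarrow> 'a"
  assumes "continuous_on UNIV (\<lambda>p. f (fst p) (snd p))"
    and "\<And>x y. x \<in> S \<Longrightarrow> y \<in> S \<Longrightarrow> f x y \<in> S"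
    and "x \<in> closure S" "y \<in> closure S"
  shows "f x y \<in> closure S"
proof -
  have "(\<lambda>p. f (fst p) (snd p)) ` closure (S \<times> S) \<subseteq> closure S"
  proof (rule image_closure_subset)
    show "(\<lambda>p. f (fst p) (snd p)) ` (S \<times> S) \<subseteq> closure S"
      using assms(2) closure_subset by fastforce
  qed (use assms(1) continuous_on_subset in auto)
  then show ?thesis
    using assms(3,4) by (force simp: closure_Times)
qed

lemma cmod_sum_mset_squares_le:
  fixes A :: "complex multiset"
  assumes "\<And>x. x \<in># A \<Longrightarrow> cmod x \<le> r"
  shows "cmod (\<Sum>x\<in>#A. x\<^sup>2) \<le> real (size A) * r\<^sup>2"
  using assms
proof (induction A)
  case (add x A)
  then have "cmod (x\<^sup>2) \<le> r\<^sup>2"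
    by (simp add: norm_power power_mono)
  moreover have "cmod (\<Sum>x\<in>#A. x\<^sup>2) \<le> real (size A) * r\<^sup>2"
    using add by simp
  ultimately show ?case
    using norm_triangle_ineq[of "x\<^sup>2" "\<Sum>x\<in>#A. x\<^sup>2"] by (simp add: algebra_simps)
qed simp

text \<open>Multiplying by \<open>[:1, -x:]\<close> turns the lowest coefficients (1, c, d) into (1,
  c - x, d - c x), so c^2 - 2 d grows by exactly x^2.\<close>

lemma coeff_prod_mset_Newton:
  fixes A :: "complex multiset"
  defines "p \<equiv> \<Prod>x\<in>#A. [:1, -x:]"
  shows "coeff p 0 = 1 \<and> (coeff p 1)\<^sup>2 - 2 * coeff p 2 = (\<Sum>x\<in>#A. x\<^sup>2)"
  unfolding p_def
proof (induction A)
  case (add x A)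
  then show ?case
    by (simp add: numeral_2_eq_2 power2_eq_square algebra_simps)
qed simp

text \<open>A constant coefficient 1 excludes the root 0, so each factor X - x can be written as -x
  (1 - X / x); \<open>A\<close> collects the reciprocals of the roots with multiplicity.\<close>

lemma prod_mset_reciprocal_roots:
  fixes q :: "complex poly"
  assumes "coeff q 0 = 1"
  obtains A where "size A = degree q" "q = (\<Prod>x\<in>#A. [:1, -x:])"
    "\<And>x. x \<in># A \<Longrightarrow> x \<noteq> 0 \<and> poly q (1 / x) = 0"
proof -
  have "q \<noteq> 0"
    using assms by auto
  then obtain B where B: "size B = degree q" "q = smult (lead_coeff q) (\<Prod>x\<in>#B. [:-x, 1:])"
    using alg_closed_imp_factorization by blast
  define A where "A = image_mset inverse B"
  have root: "poly q x = 0" if "x \<in># B" for x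
    by (subst B(2)) (use that in \<open>auto simp: poly_prod_mset image_iff\<close>)
  have nz: "x \<noteq> 0" if "x \<in># B" for x
    using root[OF that] assms by (auto simp: poly_0_coeff_0)
  have eq: "(\<Prod>x\<in>#C. [:-x, 1:]) = smult (\<Prod>x\<in>#C. -x) (\<Prod>x\<in>#C. [:1, - inverse x:])"
    if "\<forall>x\<in>#C. x \<noteq> 0" for C :: "complex multiset"
    using that
  proof (induction C)
    case (add x C)
    have "[:-x, 1:] = smult (-x) [:1, - inverse x:]"
      using add.prems by simp
    then show ?case
      using add by (simp only: image_mset_add_mset prod_mset.add_mset mult_smult_left
          mult_smult_right smult_smult) (simp add: mult.commute)
  qed simp
  have q: "q = smult (lead_coeff q * (\<Prod>x\<in>#B. -x)) (\<Prod>x\<in>#A. [:1, -x:])"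
    using B(2) eq nz by (simp add: A_def multiset.map_comp o_def)
  \<comment> \<open>Both \<open>q\<close> and the product over \<open>A\<close> have constant
    coefficient 1.\<close>
  then have "lead_coeff q * (\<Prod>x\<in>#B. -x) = 1"
    using assms coeff_prod_mset_Newton[of A] by (metis coeff_smult mult.right_neutral)
  with q have "q = (\<Prod>x\<in>#A. [:1, -x:])"
    by simp
  moreover have "x \<noteq> 0 \<and> poly q (1 / x) = 0" if "x \<in># A" for x
    using that nz root by (auto simp: A_def inverse_eq_divide)
  ultimately show ?thesis
    using that[of A] B(1) by (simp add: A_def)
qed

text \<open>Newton's identity: \<open>(coeff q 1)\<^sup>2 - 2 * coeff q 2\<close> is the sum of the squares of the
  reciprocals of the roots.\<close>

lemma coeff_bound_of_zero_free_disc: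
  fixes q :: "complex poly"
  assumes "coeff q 0 = 1" and "degree q \<le> n" and "r \<ge> 0"
    and nz: "\<And>w. cmod w * r < 1 \<Longrightarrow> poly q w \<noteq> 0"
  shows "cmod ((coeff q 1)\<^sup>2 - 2 * coeff q 2) \<le> real n * r\<^sup>2"
proof -
  obtain A where A: "size A = degree q" "q = (\<Prod>x\<in>#A. [:1, -x:])"
    "\<And>x. x \<in># A \<Longrightarrow> x \<noteq> 0 \<and> poly q (1 / x) = 0"
    using prod_mset_reciprocal_roots[OF assms(1)] by metis
  have "cmod x \<le> r" if "x \<in># A" for x
  proof (rule ccontr)
    assume "\<not> cmod x \<le> r"
    then have "cmod (1 / x) * r < 1"
      using assms(3) by (auto simp: norm_divide divide_simps)
    then show False
      using A(3)[OF that] nz by blast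
  qed
  then have "cmod (\<Sum>x\<in>#A. x\<^sup>2) \<le> real (size A) * r\<^sup>2"
    by (rule cmod_sum_mset_squares_le)
  also have "\<dots> \<le> real n * r\<^sup>2"
    using A(1) assms(2) by (simp add: mult_right_mono)
  finally show ?thesis
    using coeff_prod_mset_Newton[of A] A(2) by simp
qed

text \<open>By de Moivre, cis (pi / (2 n)) is an n-th root of \<i>, and it tends to 1 as n
  grows.\<close>

lemma root_of_imaginary_unit_near_1:
  obtains n w where "(1 + w) ^ n = \<i>" "cmod w * K < 1"
proof -
  have "(\<lambda>n. cis (pi / 2 / real n) - 1) \<longlonglongrightarrow> cis 0 - 1"
    by (intro tendsto_diff tendsto_const lim_const_over_n
        isCont_tendsto_compose[OF continuous_on_interior[OF continuous_on_cis[OF continuous_on_id, of UNIV]]])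
      simp
  then have "(\<lambda>n. cmod (cis (pi / 2 / real n) - 1) * K) \<longlonglongrightarrow> cmod (cis 0 - 1) * K"
    by (intro tendsto_mult tendsto_norm tendsto_const)
  then have "eventually (\<lambda>n. cmod (cis (pi / 2 / real n) - 1) * K < 1) sequentially"
    by (rule order_tendstoD) simp
  then obtain N where N: "\<And>n. n \<ge> N \<Longrightarrow> cmod (cis (pi / 2 / real n) - 1) * K < 1"
    by (auto simp: eventually_sequentially)
  \<comment> \<open>\<open>Suc N\<close> replaces \<open>N\<close>, which may be 0, to keep the
    denominator nonzero.\<close>
  have "real (Suc N) * (pi / 2 / real (Suc N)) = pi / 2"
    by (rule nonzero_mult_div_cancel_left[of "real (Suc N)" "pi / 2", folded times_divide_eq_right]) simp
  then have "(1 + (cis (pi / 2 / real (Suc N)) - 1)) ^ Suc N = \<i>"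
    using Complex.DeMoivre[of "pi / 2 / real (Suc N)" "Suc N"]
    by (simp only: add_diff_cancel_left' diff_add_cancel add.commute[of 1] cis_pi_half)
  moreover have "cmod (cis (pi / 2 / real (Suc N)) - 1) * K < 1"
    by (rule N) simp
  ultimately show ?thesis
    by (rule that)
qed

section \<open>Arithmetic and continuity of the Jordan product\<close>

context complex_unital_jordan_banach_algebra
begin

lemma jprod_add_left: "(x + y) \<bullet>\<^sub>J z = x \<bullet>\<^sub>J z + y \<bullet>\<^sub>J z"
  using module_hom.add[OF jprod_linear_left[THEN module_hom_iff_linear[THEN iffD2]]] .

lemma jprod_add_right: "z \<bullet>\<^sub>J (x + y) = z \<bullet>\<^sub>J x + z \<bullet>\<^sub>J y"
  using module_hom.add[OF jprod_linear_right[THEN module_hom_iff_linear[THEN iffD2]]] .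

lemma jprod_scaleC_left: "(c *\<^sub>C x) \<bullet>\<^sub>J z = c *\<^sub>C (x \<bullet>\<^sub>J z)"
  using module_hom.scale[OF jprod_linear_left[THEN module_hom_iff_linear[THEN iffD2]]] .

lemma jprod_scaleC_right: "z \<bullet>\<^sub>J (c *\<^sub>C x) = c *\<^sub>C (z \<bullet>\<^sub>J x)"
  using module_hom.scale[OF jprod_linear_right[THEN module_hom_iff_linear[THEN iffD2]]] .

lemma bounded_bilinear_jprod: "bounded_bilinear (\<bullet>\<^sub>J)"
proof
  show "\<exists>K. \<forall>a b. norm (a \<bullet>\<^sub>J b) \<le> norm a * norm b * K"
    by (rule exI[of _ 1]) (simp add: norm_jprod)
qed (simp_all add: jprod_add_left jprod_add_right scaleR_scaleC jprod_scaleC_left jprod_scaleC_right)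

lemma bounded_bilinear_scaleC: "bounded_bilinear (*\<^sub>C)"
proof
  show "\<exists>K. \<forall>a b. norm (a *\<^sub>C b) \<le> norm a * norm b * K"
    by (rule exI[of _ 1]) (simp add: norm_scaleC)
  show "(r *\<^sub>R a) *\<^sub>C b = r *\<^sub>R (a *\<^sub>C b)" for r a b
    by (simp add: scaleR_scaleC scaleR_conv_of_real)
  show "a *\<^sub>C (r *\<^sub>R b) = r *\<^sub>R (a *\<^sub>C b)" for r a b
    by (simp add: scaleR_scaleC mult.commute)
qed (simp_all add: scale_left_distrib scale_right_distrib)

lemmas jprod_diff_left = bounded_bilinear.diff_left[OF bounded_bilinear_jprod]
lemmas jprod_diff_right = bounded_bilinear.diff_right[OF bounded_bilinear_jprod]
lemmas jprod_zero_left = bounded_bilinear.zero_left[OF bounded_bilinear_jprod]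
lemmas jprod_zero_right = bounded_bilinear.zero_right[OF bounded_bilinear_jprod]
lemmas jprod_sum_right = bounded_bilinear.sum_right[OF bounded_bilinear_jprod]
lemmas continuous_on_jprod = bounded_bilinear.continuous_on[OF bounded_bilinear_jprod]
lemmas continuous_on_scaleC = bounded_bilinear.continuous_on[OF bounded_bilinear_scaleC]

lemma jprod_unit: "a \<bullet>\<^sub>J unit = a"
  by (simp add: jprod_commute[of a] unit_jprod)

section \<open>Linearised Jordan identity and power associativity\<close>

lemma jordan_linearized:
  "(x \<bullet>\<^sub>J b) \<bullet>\<^sub>J (z \<bullet>\<^sub>J y) + (z \<bullet>\<^sub>J b) \<bullet>\<^sub>J (x \<bullet>\<^sub>J y) + (y \<bullet>\<^sub>J b) \<bullet>\<^sub>J (x \<bullet>\<^sub>J z)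
    = x \<bullet>\<^sub>J (b \<bullet>\<^sub>J (z \<bullet>\<^sub>J y)) + z \<bullet>\<^sub>J (b \<bullet>\<^sub>J (x \<bullet>\<^sub>J y)) + y \<bullet>\<^sub>J (b \<bullet>\<^sub>J (x \<bullet>\<^sub>J z))"
  (is "?l = ?r")
proof -
  define f where "f a = (a \<bullet>\<^sub>J b) \<bullet>\<^sub>J (a \<bullet>\<^sub>J a) - a \<bullet>\<^sub>J (b \<bullet>\<^sub>J (a \<bullet>\<^sub>J a))" for a
  \<comment> \<open>The defect \<open>f\<close> is cubic in \<open>a\<close>; the alternating sum
    keeps only the part linear in each of \<open>x\<close>, \<open>y\<close>, \<open>z\<close>. The
    six orderings of these agree in pairs by commutativity, hence the factor 2.\<close>
  have "f (x + y + z) - f (x + y) - f (x + z) - f (y + z) + f x + f y + f z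
      = 2 *\<^sub>R (?l - ?r)"
    unfolding f_def
    by (simp add: jprod_add_left jprod_add_right jprod_commute[of y x] jprod_commute[of z x]
        jprod_commute[of z y] algebra_simps scaleR_2)
  moreover have "f a = 0" for a
    by (simp add: f_def jordan_identity)
  ultimately show ?thesis
    by simp
qed

text \<open>The product is not associative, so a bracketing of the powers is fixed;
  \<open>jpow_jprod_jpow\<close> shows that products of powers are again powers.\<close>

fun jpow :: "'a \<Rightarrow> nat \<Rightarrow> 'a" where
  "jpow a 0 = unit"
| "jpow a (Suc n) = a \<bullet>\<^sub>J jpow a n"

text \<open>The linearised identity at \<open>a\<close>, \<open>a\<close>, \<open>z\<close> and
  \<open>jpow a n\<close>, solved for one term. It gives a second-order recurrence for the operators
  of multiplication by powers of \<open>a\<close>.\<close>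

lemma jpow_Suc_Suc_jprod:
  "jpow a (Suc (Suc n)) \<bullet>\<^sub>J z
    = (a \<bullet>\<^sub>J a) \<bullet>\<^sub>J (jpow a n \<bullet>\<^sub>J z) + 2 *\<^sub>R (jpow a (Suc n) \<bullet>\<^sub>J (a \<bullet>\<^sub>J z))
      - a \<bullet>\<^sub>J (a \<bullet>\<^sub>J (jpow a n \<bullet>\<^sub>J z)) - jpow a n \<bullet>\<^sub>J (a \<bullet>\<^sub>J (a \<bullet>\<^sub>J z))"
  using jordan_linearized[of a a z "jpow a n"]
  by (simp add: jprod_commute[of z "jpow a n"] jprod_commute[of z a] jprod_commute[of "jpow a n" a]
      jprod_commute[of z "a \<bullet>\<^sub>J (a \<bullet>\<^sub>J jpow a n)"]
      jprod_commute[of "a \<bullet>\<^sub>J z" "a \<bullet>\<^sub>J jpow a n"] scaleR_2 algebra_simps)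

text \<open>By the recurrence, multiplication by a power of \<open>a\<close> is built from the
  multiplications by \<open>a\<close> and by its square, with which \<open>T\<close>
  commutes.\<close>

lemma commute_jprod_jpow:
  assumes "Modules.additive T" and "\<And>z. T (a \<bullet>\<^sub>J z) = a \<bullet>\<^sub>J T z"
    and "\<And>z. T ((a \<bullet>\<^sub>J a) \<bullet>\<^sub>J z) = (a \<bullet>\<^sub>J a) \<bullet>\<^sub>J T z"
  shows "T (jpow a n \<bullet>\<^sub>J z) = jpow a n \<bullet>\<^sub>J T z"
proof -
  interpret T: Modules.additive T by fact
  \<comment> \<open>Two consecutive exponents are carried along because the recurrence has order
    two.\<close>
  have "(\<forall>z. T (jpow a n \<bullet>\<^sub>J z) = jpow a n \<bullet>\<^sub>J T z) \<and>
    (\<forall>z. T (jpow a (Suc n) \<bullet>\<^sub>J z) = jpow a (Suc n) \<bullet>\<^sub>J T z)"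
  proof (induction n)
    case 0
    then show ?case by (simp add: unit_jprod jprod_unit assms)
  next
    case (Suc n)
    then show ?case
      unfolding jpow_Suc_Suc_jprod by (simp add: T.add T.diff assms scaleR_2)
  qed
  then show ?thesis by blast
qed

lemma additive_jprod: "Modules.additive ((\<bullet>\<^sub>J) a)"
  by unfold_locales (rule jprod_add_right)

lemma jpow_jprod_commute:
  "jpow a m \<bullet>\<^sub>J (jpow a n \<bullet>\<^sub>J z) = jpow a n \<bullet>\<^sub>J (jpow a m \<bullet>\<^sub>J z)"
proof -
  \<comment> \<open>The Jordan identity in operator form. It starts a bootstrap: \<open>T\<close> is
    first multiplication by \<open>a\<close> or its square, then by an arbitrary power.\<close>
  have sq: "a \<bullet>\<^sub>J ((a \<bullet>\<^sub>J a) \<bullet>\<^sub>J z) = (a \<bullet>\<^sub>J a) \<bullet>\<^sub>J (a \<bullet>\<^sub>J z)" for z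
    using jordan_identity[of a z] by (simp add: jprod_commute)
  have 1: "a \<bullet>\<^sub>J (jpow a n \<bullet>\<^sub>J z) = jpow a n \<bullet>\<^sub>J (a \<bullet>\<^sub>J z)" for n z
    by (rule commute_jprod_jpow) (simp_all add: additive_jprod sq)
  have 2: "(a \<bullet>\<^sub>J a) \<bullet>\<^sub>J (jpow a n \<bullet>\<^sub>J z) = jpow a n \<bullet>\<^sub>J ((a \<bullet>\<^sub>J a) \<bullet>\<^sub>J z)" for n z
    by (rule commute_jprod_jpow) (simp_all add: additive_jprod sq)
  show ?thesis
    by (rule commute_jprod_jpow) (simp_all add: additive_jprod 1 2)
qed

lemma jpow_jprod_jpow: "jpow a m \<bullet>\<^sub>J jpow a n = jpow a (m + n)"
proof (induction n)
  case 0
  then show ?case by (simp add: jprod_unit)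
next
  case (Suc n)
  have "jpow a m \<bullet>\<^sub>J jpow a (Suc n) = a \<bullet>\<^sub>J (jpow a m \<bullet>\<^sub>J jpow a n)"
    using jpow_jprod_commute[of a m 1 "jpow a n"] by (simp add: jprod_unit)
  with Suc show ?case by simp
qed

section \<open>The closed associative subalgebra generated by one element\<close>

definition generated :: "'a \<Rightarrow> 'a set" where
  "generated a = closure (span (range (jpow a)))"

lemma jpow_in_generated: "jpow a n \<in> generated a"
  unfolding generated_def by (rule subsetD[OF closure_subset], rule span_base) simp

lemma unit_in_generated: "unit \<in> generated a"
  using jpow_in_generated[of a 0] by simp

lemma self_in_generated: "a \<in> generated a"
  using jpow_in_generated[of a 1] by (simp add: jprod_unit)

lemma add_in_generated: "x \<in> generated a \<Longrightarrow> y \<in> generated a \<Longrightarrow> x + y \<in> generated a"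
  unfolding generated_def
  by (rule closure_closed_under[where f = "(+)"])
    (assumption | erule (1) span_add | intro continuous_intros)+

lemma diff_in_generated: "x \<in> generated a \<Longrightarrow> y \<in> generated a \<Longrightarrow> x - y \<in> generated a"
  unfolding generated_def
  by (rule closure_closed_under[where f = "(-)"])
    (assumption | erule (1) span_diff | intro continuous_intros)+

lemma jprod_in_generated:
  assumes "x \<in> generated a" "y \<in> generated a"
  shows "x \<bullet>\<^sub>J y \<in> generated a"
proof -
  let ?S = "span (range (jpow a))"
  \<comment> \<open>Linear extension in the first factor; commutativity transfers it to the second
    one, and continuity to the closure.\<close>
  have vimage: "?S \<subseteq> {x. x \<bullet>\<^sub>J y \<in> ?S}" if "\<And>n. jpow a n \<bullet>\<^sub>J y \<in> ?S" for y
  proof (rule span_minimal)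
    show "subspace {x. x \<bullet>\<^sub>J y \<in> ?S}"
      by (rule subspaceI) (simp_all add: jprod_add_left jprod_scaleC_left jprod_zero_left
          span_zero span_add span_scale)
  qed (use that in auto)
  have "jpow a m \<bullet>\<^sub>J jpow a n \<in> ?S" for m n
    by (simp add: jpow_jprod_jpow span_base)
  then have 1: "jpow a n \<bullet>\<^sub>J x \<in> ?S" if "x \<in> ?S" for x n
    using vimage[of "jpow a n"] that by (auto simp: jprod_commute[of "jpow a n" x])
  have "x \<bullet>\<^sub>J y \<in> ?S" if "x \<in> ?S" "y \<in> ?S" for x y
    using vimage[of y] 1 that by blast
  with assms show ?thesis
    unfolding generated_def
    by (intro closure_closed_under[where f = "(\<bullet>\<^sub>J)"] continuous_on_jprod continuous_on_fst
        continuous_on_snd continuous_on_id)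
qed

text \<open>The elements whose multiplication commutes with that by \<open>y\<close> form a closed
  subspace \<open>C y\<close>, which contains \<open>generated a\<close> once it contains the powers
  of \<open>a\<close>. The relation is symmetric, so it extends first in \<open>x\<close> and then
  in \<open>y\<close>.\<close>

lemma generated_commute:
  assumes "x \<in> generated a" "y \<in> generated a"
  shows "x \<bullet>\<^sub>J (y \<bullet>\<^sub>J z) = y \<bullet>\<^sub>J (x \<bullet>\<^sub>J z)"
proof -
  define C where "C y = {x. \<forall>z. x \<bullet>\<^sub>J (y \<bullet>\<^sub>J z) = y \<bullet>\<^sub>J (x \<bullet>\<^sub>J z)}" for y
  have gen: "generated a \<subseteq> C y" if "range (jpow a) \<subseteq> C y" for y
    unfolding generated_def
  proof (intro closure_minimal span_minimal that)
    show "closed (C y)"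
      unfolding C_def
    proof (rule closed_Collect_all, rule closed_Collect_eq)
      show "continuous_on UNIV (\<lambda>x. x \<bullet>\<^sub>J (y \<bullet>\<^sub>J z))" for z
        by (rule continuous_on_jprod) (rule continuous_on_id continuous_on_const)+
      show "continuous_on UNIV (\<lambda>x. y \<bullet>\<^sub>J (x \<bullet>\<^sub>J z))" for z
        by (rule continuous_on_jprod[OF continuous_on_const])
          (rule continuous_on_jprod continuous_on_id continuous_on_const)+
    qed
    show "subspace (C y)"
      unfolding C_def
      by (rule subspaceI)
        (simp_all add: jprod_add_left jprod_add_right jprod_scaleC_left jprod_scaleC_right
          jprod_zero_left jprod_zero_right)
  qed
  have "range (jpow a) \<subseteq> C (jpow a n)" for n
    by (auto simp: C_def jpow_jprod_commute)
  then have "x \<in> C (jpow a n)" for n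
    using gen assms(1) by blast
  then have "range (jpow a) \<subseteq> C x"
    by (auto simp: C_def)
  then have "y \<in> C x"
    using gen assms(2) by blast
  then show ?thesis
    by (simp add: C_def)
qed

lemma generated_assoc:
  assumes "x \<in> generated a" "y \<in> generated a" "z \<in> generated a"
  shows "(x \<bullet>\<^sub>J y) \<bullet>\<^sub>J z = x \<bullet>\<^sub>J (y \<bullet>\<^sub>J z)"
  using generated_commute[OF assms(3,1), of y] by (simp add: jprod_commute[of _ z] jprod_commute[of y z])

lemma jpow_closed:
  assumes "x \<in> generated a"
  shows "jpow x n \<in> generated a"
  by (induction n) (simp_all add: unit_in_generated jprod_in_generated assms)

section \<open>Invertible elements and the principal component\<close>

lemma jpow_invertible:
  assumes "norm c < 1"
  shows "jpow (unit + c) n \<in> jordan_invertibles (\<bullet>\<^sub>J) unit"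
proof -
  let ?G = "generated c" and ?x = "unit + c"
  \<comment> \<open>A fixed point of this contraction satisfies (1 + c) y = 1. Completeness of
    \<open>?G\<close> keeps the inverse inside the associative subalgebra, which a bare inverse in
    the whole algebra would not give.\<close>
  have "\<exists>!y. y \<in> ?G \<and> unit - c \<bullet>\<^sub>J y = y"
  proof (rule Banach_fix[of ?G "norm c"])
    show "complete ?G"
      by (simp add: generated_def complete_eq_closed del: closure_closed)
    show "dist (unit - c \<bullet>\<^sub>J x) (unit - c \<bullet>\<^sub>J y) \<le> norm c * dist x y" for x y
      using norm_jprod[of c "y - x"] by (simp add: dist_norm jprod_diff_right norm_minus_commute)
  qed (use assms unit_in_generated in \<open>auto intro!: diff_in_generated jprod_in_generated self_in_generated\<close>)
  then obtain y where y: "y \<in> ?G" "unit - c \<bullet>\<^sub>J y = y"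
    by blast
  have x: "?x \<in> ?G"
    by (intro add_in_generated unit_in_generated self_in_generated)
  have xy: "?x \<bullet>\<^sub>J y = unit"
    using y(2) by (metis diff_add_cancel jprod_add_left unit_jprod)
  note G = jpow_closed[OF x] jpow_closed[OF y(1)] jprod_in_generated[of _ c] x y(1)
  have inv: "jpow ?x n \<bullet>\<^sub>J jpow y n = unit" for n
  proof (induction n)
    case (Suc n)
    have "jpow ?x (Suc n) \<bullet>\<^sub>J jpow y (Suc n) = ?x \<bullet>\<^sub>J (jpow ?x n \<bullet>\<^sub>J (y \<bullet>\<^sub>J jpow y n))"
      by (simp add: generated_assoc[OF x G(1)] G)
    also have "\<dots> = ?x \<bullet>\<^sub>J (y \<bullet>\<^sub>J (jpow ?x n \<bullet>\<^sub>J jpow y n))"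
      using generated_commute[OF G(1) y(1)] by simp
    finally show ?case
      using Suc xy by (simp add: jprod_unit)
  qed (simp add: unit_jprod)
  \<comment> \<open>The second condition for Jordan invertibility follows from associativity in
    \<open>?G\<close>.\<close>
  have "(jpow ?x n \<bullet>\<^sub>J jpow ?x n) \<bullet>\<^sub>J jpow y n = jpow ?x n"
    by (simp add: generated_assoc[OF G(1) G(1) G(2)] inv jprod_unit)
  then show ?thesis
    unfolding jordan_invertibles_def using inv by blast
qed

abbreviation principal :: "'a set" where
  "principal \<equiv> principal_component (\<bullet>\<^sub>J) unit"

lemma scaleC_invertible:
  assumes "\<mu> \<noteq> 0" "x \<in> jordan_invertibles (\<bullet>\<^sub>J) unit"
  shows "\<mu> *\<^sub>C x \<in> jordan_invertibles (\<bullet>\<^sub>J) unit"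
proof -
  obtain y where y: "x \<bullet>\<^sub>J y = unit" "(x \<bullet>\<^sub>J x) \<bullet>\<^sub>J y = x"
    using assms(2) by (auto simp: jordan_invertibles_def)
  then show ?thesis
    unfolding jordan_invertibles_def using assms(1)
    by (auto intro!: exI[of _ "inverse \<mu> *\<^sub>C y"] simp: jprod_scaleC_left jprod_scaleC_right)
qed

text \<open>The punctured complex plane is connected, and its multiples of \<open>x\<close> join
  \<open>x\<close> to \<open>\<mu> *\<^sub>C x\<close> within the invertible elements.\<close>

lemma scaleC_in_principal:
  assumes "\<mu> \<noteq> 0" "x \<in> principal"
  shows "\<mu> *\<^sub>C x \<in> principal"
proof -
  let ?I = "jordan_invertibles (\<bullet>\<^sub>J) unit"
  have x: "connected_component ?I unit x"
    using assms(2) by (simp add: principal_component_def)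
  have "connected ((\<lambda>z. z *\<^sub>C x) ` (- {0::complex}))"
    by (intro connected_continuous_image continuous_on_scaleC continuous_intros
        connected_punctured_universe) simp
  then have "connected_component ?I x (\<mu> *\<^sub>C x)"
  proof (rule connected_componentI)
    show "(\<lambda>z. z *\<^sub>C x) ` (- {0::complex}) \<subseteq> ?I"
      using scaleC_invertible connected_component_in[OF x] by auto
    show "x \<in> (\<lambda>z. z *\<^sub>C x) ` (- {0::complex})"
      by (rule image_eqI[of _ _ 1]) simp_all
  qed (use assms(1) in auto)
  then show ?thesis
    using x connected_component_trans by (auto simp: principal_component_def)
qed

lemma continuous_on_jpow:
  "continuous_on S f \<Longrightarrow> continuous_on S (\<lambda>t. jpow (f t) n)"
  by (induction n) (auto intro!: continuous_on_jprod)

lemma jpow_unit: "jpow unit n = unit"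
  by (induction n) (simp_all add: unit_jprod)

text \<open>The segment from \<open>unit\<close> to \<open>unit + c\<close> stays at distance less
  than 1 from \<open>unit\<close>, so its n-th powers form a path of invertible elements.\<close>

lemma jpow_in_principal:
  assumes "norm c < 1"
  shows "jpow (unit + c) n \<in> principal"
proof -
  let ?f = "\<lambda>t::real. jpow (unit + t *\<^sub>R c) n"
  have "connected (?f ` {0..1})"
    by (intro connected_continuous_image continuous_on_jpow continuous_intros) simp
  then have "connected_component (jordan_invertibles (\<bullet>\<^sub>J) unit) unit (jpow (unit + c) n)"
  proof (rule connected_componentI)
    show "?f ` {0..1} \<subseteq> jordan_invertibles (\<bullet>\<^sub>J) unit"
    proof
      fix y assume "y \<in> ?f ` {0..1}"
      then obtain t where t: "0 \<le> t" "t \<le> 1" "y = ?f t"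
        by auto
      have "norm (t *\<^sub>R c) < 1"
        using t assms by (smt (verit) mult_left_le_one_le norm_ge_zero norm_scaleR)
      then show "y \<in> jordan_invertibles (\<bullet>\<^sub>J) unit"
        using jpow_invertible t(3) by simp
    qed
    show "unit \<in> ?f ` {0..1}"
      by (rule image_eqI[of _ _ 0]) (simp_all add: jpow_unit)
    show "jpow (unit + c) n \<in> ?f ` {0..1}"
      by (rule image_eqI[of _ _ 1]) simp_all
  qed
  then show ?thesis
    by (simp add: principal_component_def)
qed

lemma unit_in_principal: "unit \<in> principal"
  using jpow_in_principal[of 0 0] by simp

section \<open>Multiplicativity of functionals without zeros on the principal component\<close>

lemma jpow_unit_add:
  "jpow (unit + c) n = (\<Sum>k\<le>n. of_nat (n choose k) *\<^sub>C jpow c k)"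
proof (induction n)
  case (Suc n)
  have "jpow (unit + c) (Suc n) = (\<Sum>k\<le>n. of_nat (n choose k) *\<^sub>C jpow c k)
      + (\<Sum>k\<le>n. of_nat (n choose k) *\<^sub>C jpow c (Suc k))"
    by (simp add: Suc jprod_add_left unit_jprod jprod_sum_right jprod_scaleC_right scale_right_distrib
          sum.distrib)
  also have "(\<Sum>k\<le>n. of_nat (n choose k) *\<^sub>C jpow c k)
      = (\<Sum>k\<le>Suc n. of_nat (n choose k) *\<^sub>C jpow c k)"
    by (simp add: binomial_eq_0)
  also have "\<dots> = unit + (\<Sum>k\<le>n. of_nat (n choose Suc k) *\<^sub>C jpow c (Suc k))"
    by (subst sum.atMost_Suc_shift) simp
  also have "\<dots> + (\<Sum>k\<le>n. of_nat (n choose k) *\<^sub>C jpow c (Suc k))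
      = (\<Sum>k\<le>Suc n. of_nat (Suc n choose k) *\<^sub>C jpow c k)"
    by (subst sum.atMost_Suc_shift)
      (simp add: sum.distrib[symmetric] scale_left_distrib add.commute add.left_commute del: jpow.simps(2))
  finally show ?case .
qed simp

lemma jpow_scaleC: "jpow (z *\<^sub>C a) n = z ^ n *\<^sub>C jpow a n"
  by (induction n) (simp_all add: jprod_scaleC_left jprod_scaleC_right mult.commute)

text \<open>A Gleason-Kahane-Zelazko argument: first squares, by a bound on polynomials of degree at
  most n, then all products by polarisation.\<close>

lemma character_of_nonzero_on_principal:
  assumes lin: "Vector_Spaces.linear scaleC (*) \<psi>" and one: "\<psi> unit = 1"
    and nz: "\<And>x. x \<in> principal \<Longrightarrow> \<psi> x \<noteq> 0"
  shows "\<psi> (a \<bullet>\<^sub>J b) = \<psi> a * \<psi> b"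
proof -
  interpret \<psi>: Vector_Spaces.linear scaleC "(*)" \<psi>
    by fact
  have sq: "\<psi> (a \<bullet>\<^sub>J a) = (\<psi> a)\<^sup>2" for a
  proof -
    define d where "d = (\<psi> a)\<^sup>2 - \<psi> (a \<bullet>\<^sub>J a)"
    \<comment> \<open>The right-hand side does not depend on \<open>n\<close>, so these bounds force
      \<open>d = 0\<close>.\<close>
    have bound: "real n * cmod d \<le> (norm a)\<^sup>2 + cmod (\<psi> (a \<bullet>\<^sub>J a))" if "n > 0" for n
    proof -
      define q where "q = (\<Sum>k\<le>n. monom (of_nat (n choose k) * (-1) ^ k * \<psi> (jpow a k)) k)"
      have coeff_q: "coeff q k = of_nat (n choose k) * (-1) ^ k * \<psi> (jpow a k)" for k
        by (simp add: q_def coeff_sum binomial_eq_0)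
      have poly_q: "poly q w = \<psi> (jpow (unit + (- w) *\<^sub>C a) n)" for w
        unfolding jpow_unit_add jpow_scaleC \<psi>.sum \<psi>.scale q_def
        by (simp add: poly_sum poly_monom power_minus[of w] algebra_simps)
      have coeff_bound: "cmod ((coeff q 1)\<^sup>2 - 2 * coeff q 2) \<le> real n * (norm a)\<^sup>2"
      proof (rule coeff_bound_of_zero_free_disc)
        show "coeff q 0 = 1"
          by (simp add: coeff_q one)
        show "degree q \<le> n"
          by (rule degree_le) (simp add: coeff_q binomial_eq_0)
        show "poly q w \<noteq> 0" if "cmod w * norm a < 1" for w
          unfolding poly_q using that by (intro nz jpow_in_principal) (simp add: norm_scaleC)
      qed simp
      \<comment> \<open>\<open>n > 0\<close> makes the truncated difference n - 1 agree with the
        complex one.\<close>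
      have "2 * of_nat (n choose 2) = (of_nat n * (of_nat n - 1) :: complex)"
      proof -
        have "2 * (n choose 2) = n * (n - 1)"
          unfolding choose_two by (rule dvd_mult_div_cancel) auto
        then show ?thesis
          using that by (metis of_nat_mult of_nat_numeral of_nat_1 of_nat_diff One_nat_def Suc_leI)
      qed
      moreover have "coeff q 1 = - (of_nat n * \<psi> a)"
        by (simp add: coeff_q jprod_unit)
      moreover have "coeff q 2 = of_nat (n choose 2) * \<psi> (a \<bullet>\<^sub>J a)"
        unfolding coeff_q by (simp add: numeral_2_eq_2 jprod_unit)
      ultimately have "(coeff q 1)\<^sup>2 - 2 * coeff q 2
          = (of_nat n * \<psi> a)\<^sup>2 - of_nat n * (of_nat n - 1) * \<psi> (a \<bullet>\<^sub>J a)"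
        by (simp only: mult.assoc[symmetric] power2_minus)
      \<comment> \<open>One factor n cancels against the bound, and \<open>d\<close> still carries
        another.\<close>
      also have "\<dots> = of_nat n * (of_nat n * d + \<psi> (a \<bullet>\<^sub>J a))"
        by (simp add: d_def power2_eq_square algebra_simps)
      finally have "cmod (of_nat n * (of_nat n * d + \<psi> (a \<bullet>\<^sub>J a))) \<le> real n * (norm a)\<^sup>2"
        using coeff_bound by simp
      then have "cmod (of_nat n * d + \<psi> (a \<bullet>\<^sub>J a)) \<le> (norm a)\<^sup>2"
        using that by (simp add: norm_mult)
      moreover have "cmod (of_nat n * d) \<le> cmod (of_nat n * d + \<psi> (a \<bullet>\<^sub>J a)) + cmod (\<psi> (a \<bullet>\<^sub>J a))"
        using norm_triangle_ineq4[of "of_nat n * d + \<psi> (a \<bullet>\<^sub>J a)" "\<psi> (a \<bullet>\<^sub>J a)"] by simp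
      ultimately show ?thesis
        by (simp add: norm_mult)
    qed
    have "d = 0"
    proof (rule ccontr)
      assume "d \<noteq> 0"
      then obtain n where n: "(norm a)\<^sup>2 + cmod (\<psi> (a \<bullet>\<^sub>J a)) < real n * cmod d"
        using reals_Archimedean3[of "cmod d"] by auto
      moreover have "(norm a)\<^sup>2 + cmod (\<psi> (a \<bullet>\<^sub>J a)) \<ge> 0"
        by simp
      ultimately have "n > 0"
        by (cases n) auto
      then show False
        using bound[of n] n by simp
    qed
    then show ?thesis
      by (simp add: d_def)
  qed
  have "2 * \<psi> (a \<bullet>\<^sub>J b) = \<psi> ((a + b) \<bullet>\<^sub>J (a + b)) - \<psi> (a \<bullet>\<^sub>J a) - \<psi> (b \<bullet>\<^sub>J b)"
    by (simp add: jprod_add_left jprod_add_right jprod_commute[of b a] \<psi>.add)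
  also have "\<dots> = 2 * (\<psi> a * \<psi> b)"
    by (simp add: sq \<psi>.add power2_eq_square algebra_simps)
  finally show ?thesis
    by simp
qed

section \<open>From real-linear to complex linear functionals\<close>

lemma character_jpow:
  assumes "\<And>a b. \<psi> (a \<bullet>\<^sub>J b) = \<psi> a * \<psi> b" and "\<psi> unit = (1 :: complex)"
  shows "\<psi> (jpow a n) = \<psi> a ^ n"
  by (induction n) (simp_all add: assms)

lemma scaleC_Re_Im: "c *\<^sub>C a = Re c *\<^sub>R a + Im c *\<^sub>R (\<i> *\<^sub>C a)"
  by (simp add: scaleR_scaleC scale_left_distrib[symmetric] complex_eq[symmetric] mult.commute[of _ \<i>])

text \<open>The functional \<rho>(a) - \<i> \<rho>(\<i> a) is the complex linear functional with
  real part \<rho>.\<close>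

lemma complex_linear_of_real_part:
  assumes "linear \<rho>"
  shows "Vector_Spaces.linear scaleC (*) (\<lambda>a. Complex (\<rho> a) (- \<rho> (\<i> *\<^sub>C a)))"
proof -
  have add: "\<rho> (x + y) = \<rho> x + \<rho> y" for x y
    by (rule Real_Vector_Spaces.linear_add[OF assms])
  have scale: "\<rho> (r *\<^sub>R x) = r * \<rho> x" for r x
    using Real_Vector_Spaces.linear_scale[OF assms] by simp
  have scaleC: "\<rho> (c *\<^sub>C x) = Re c * \<rho> x + Im c * \<rho> (\<i> *\<^sub>C x)" for c x
    by (subst scaleC_Re_Im) (simp only: add scale)
  have "\<rho> (- x) = - \<rho> x" for x
    using scale[of "-1" x] by simp
  then have i_scaleC: "\<rho> (\<i> *\<^sub>C (c *\<^sub>C x)) = Re c * \<rho> (\<i> *\<^sub>C x) - Im c * \<rho> x" for c x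
    using scaleC[of c "\<i> *\<^sub>C x"] by (simp add: mult.commute[of \<i> c])
  show ?thesis
  proof unfold_locales
    show "Complex (\<rho> (c *\<^sub>C x)) (- \<rho> (\<i> *\<^sub>C (c *\<^sub>C x)))
        = c * Complex (\<rho> x) (- \<rho> (\<i> *\<^sub>C x))" for c x
      unfolding i_scaleC by (subst scaleC) (simp add: complex_eq_iff)
  qed (simp add: add scale_right_distrib complex_eq_iff)
qed

text \<open>The separating element is \<open>(1 + c)\<^sup>n\<close> with \<open>c\<close> in the span of \<open>1\<close> and \<open>a\<close>.\<close>

lemma characters_separated_on_principal:
  assumes lin: "Vector_Spaces.linear scaleC (*) \<psi>\<^sub>1" "Vector_Spaces.linear scaleC (*) \<psi>\<^sub>2"
    and one: "\<psi>\<^sub>1 unit = 1" "\<psi>\<^sub>2 unit = 1"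
    and mult: "\<And>a b. \<psi>\<^sub>1 (a \<bullet>\<^sub>J b) = \<psi>\<^sub>1 a * \<psi>\<^sub>1 b" "\<And>a b. \<psi>\<^sub>2 (a \<bullet>\<^sub>J b) = \<psi>\<^sub>2 a * \<psi>\<^sub>2 b"
    and neq: "\<psi>\<^sub>1 a \<noteq> \<psi>\<^sub>2 a"
  obtains b where "b \<in> principal" "\<psi>\<^sub>1 b = \<i>" "\<psi>\<^sub>2 b = 1"
proof -
  interpret \<psi>\<^sub>1: Vector_Spaces.linear scaleC "(*)" \<psi>\<^sub>1 by fact
  interpret \<psi>\<^sub>2: Vector_Spaces.linear scaleC "(*)" \<psi>\<^sub>2 by fact
  \<comment> \<open>Subtracting the multiple of \<open>unit\<close> makes
    \<open>\<psi>\<^sub>2\<close> vanish, and the factor normalises \<open>\<psi>\<^sub>1\<close>;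
    so \<open>unit + w *\<^sub>C u\<close> has the values 1 + w and 1.\<close>
  define u where "u = inverse (\<psi>\<^sub>1 a - \<psi>\<^sub>2 a) *\<^sub>C (a - \<psi>\<^sub>2 a *\<^sub>C unit)"
  have u: "\<psi>\<^sub>1 u = 1" "\<psi>\<^sub>2 u = 0"
    using neq by (simp_all add: u_def \<psi>\<^sub>1.scale \<psi>\<^sub>2.scale \<psi>\<^sub>1.diff \<psi>\<^sub>2.diff one)
  obtain n w where w: "(1 + w) ^ n = \<i>" "cmod w * norm u < 1"
    by (rule root_of_imaginary_unit_near_1)
  show ?thesis
  proof (rule that)
    show "jpow (unit + w *\<^sub>C u) n \<in> principal"
      using w(2) by (intro jpow_in_principal) (simp add: norm_scaleC)
    show "\<psi>\<^sub>1 (jpow (unit + w *\<^sub>C u) n) = \<i>"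
      using w(1) by (simp add: character_jpow[OF mult(1) one(1)] \<psi>\<^sub>1.add \<psi>\<^sub>1.scale one u)
    show "\<psi>\<^sub>2 (jpow (unit + w *\<^sub>C u) n) = 1"
      by (simp add: character_jpow[OF mult(2) one(2)] \<psi>\<^sub>2.add \<psi>\<^sub>2.scale one u)
  qed
qed

lemma character_of_exponential_spectrum:
  assumes lin: "linear \<phi>"
    and spec: "\<And>a. \<phi> a \<in> exponential_spectrum scaleC (\<bullet>\<^sub>J) unit a"
  shows "Vector_Spaces.linear scaleC (*) \<phi> \<and> (\<forall>a b. \<phi> (a \<bullet>\<^sub>J b) = \<phi> a * \<phi> b)"
proof -
  have nz: "\<phi> x \<noteq> 0" if "x \<in> principal" for x
    using spec[of x] that by (auto simp: exponential_spectrum_def)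
  \<comment> \<open>Nonzero multiples of \<open>unit\<close> are principal, so \<open>c\<close> is
    the only point in the exponential spectrum of \<open>c *\<^sub>C unit\<close>.\<close>
  have \<phi>_unit: "\<phi> (c *\<^sub>C unit) = c" for c
  proof (rule ccontr)
    assume "\<phi> (c *\<^sub>C unit) \<noteq> c"
    then have "(c - \<phi> (c *\<^sub>C unit)) *\<^sub>C unit \<in> principal"
      by (intro scaleC_in_principal unit_in_principal) simp
    then show False
      using spec[of "c *\<^sub>C unit"] by (simp add: exponential_spectrum_def scale_left_diff_distrib)
  qed
  define \<psi>\<^sub>1 where "\<psi>\<^sub>1 a = Complex (Re (\<phi> a)) (- Re (\<phi> (\<i> *\<^sub>C a)))" for a
  \<comment> \<open>The factor \<i> turns the prescribed real part into a prescribed imaginary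
    part.\<close>
  define \<psi>\<^sub>2 where "\<psi>\<^sub>2 a = \<i> * Complex (Im (\<phi> a)) (- Im (\<phi> (\<i> *\<^sub>C a)))" for a
  have lin1: "Vector_Spaces.linear scaleC (*) \<psi>\<^sub>1"
    unfolding \<psi>\<^sub>1_def
    using complex_linear_of_real_part[OF linear_compose[OF lin bounded_linear.linear[OF bounded_linear_Re]]]
    by (simp add: o_def)
  have "Vector_Spaces.linear scaleC (*) (\<lambda>a. Complex (Im (\<phi> a)) (- Im (\<phi> (\<i> *\<^sub>C a))))"
    using complex_linear_of_real_part[OF linear_compose[OF lin bounded_linear.linear[OF bounded_linear_Im]]]
    by (simp add: o_def)
  then interpret \<psi>: Vector_Spaces.linear scaleC "(*)" "\<lambda>a. Complex (Im (\<phi> a)) (- Im (\<phi> (\<i> *\<^sub>C a)))" .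
  have lin2: "Vector_Spaces.linear scaleC (*) \<psi>\<^sub>2"
    unfolding \<psi>\<^sub>2_def
    by unfold_locales (simp_all only: \<psi>.add \<psi>.scale distrib_left mult.left_commute)
  interpret \<psi>\<^sub>1: Vector_Spaces.linear scaleC "(*)" \<psi>\<^sub>1 by (rule lin1)
  interpret \<psi>\<^sub>2: Vector_Spaces.linear scaleC "(*)" \<psi>\<^sub>2 by (rule lin2)
  have \<phi>_eq: "\<phi> a = Complex (Re (\<psi>\<^sub>1 a)) (Im (\<psi>\<^sub>2 a))" for a
    by (simp add: \<psi>\<^sub>1_def \<psi>\<^sub>2_def)
  have one: "\<psi>\<^sub>1 unit = 1" "\<psi>\<^sub>2 unit = 1"
    using \<phi>_unit[of 1] \<phi>_unit[of \<i>] by (simp_all add: \<psi>\<^sub>1_def \<psi>\<^sub>2_def complex_eq_iff)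
  have nz1: "\<psi>\<^sub>1 x \<noteq> 0" if x: "x \<in> principal" for x
  proof
    assume 0: "\<psi>\<^sub>1 x = 0"
    \<comment> \<open>The conjugate makes \<open>\<psi>\<^sub>2 (c *\<^sub>C x)\<close> real, so its
      contribution to \<open>\<phi>\<close> vanishes; the value 1 keeps \<open>c\<close>
      nonzero.\<close>
    define c where "c = (if \<psi>\<^sub>2 x = 0 then 1 else cnj (\<psi>\<^sub>2 x))"
    have "\<phi> (c *\<^sub>C x) = 0"
      by (simp add: \<phi>_eq \<psi>\<^sub>1.scale \<psi>\<^sub>2.scale 0 c_def complex_eq_iff)
    moreover have "c *\<^sub>C x \<in> principal"
      by (rule scaleC_in_principal[OF _ x]) (simp add: c_def)
    ultimately show False
      using nz by blast
  qed
  have nz2: "\<psi>\<^sub>2 x \<noteq> 0" if x: "x \<in> principal" for x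
  proof
    assume 0: "\<psi>\<^sub>2 x = 0"
    \<comment> \<open>Here \<open>\<psi>\<^sub>1 (c *\<^sub>C x)\<close> has to be purely imaginary,
      hence the extra \<i>.\<close>
    define c where "c = (if \<psi>\<^sub>1 x = 0 then 1 else \<i> * cnj (\<psi>\<^sub>1 x))"
    have "\<phi> (c *\<^sub>C x) = 0"
      by (simp add: \<phi>_eq \<psi>\<^sub>1.scale \<psi>\<^sub>2.scale 0 c_def complex_eq_iff)
    moreover have "c *\<^sub>C x \<in> principal"
      by (rule scaleC_in_principal[OF _ x]) (simp add: c_def)
    ultimately show False
      using nz by blast
  qed
  have mult: "\<psi>\<^sub>1 (a \<bullet>\<^sub>J b) = \<psi>\<^sub>1 a * \<psi>\<^sub>1 b" "\<psi>\<^sub>2 (a \<bullet>\<^sub>J b) = \<psi>\<^sub>2 a * \<psi>\<^sub>2 b" for a b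
    using character_of_nonzero_on_principal[OF lin1 one(1) nz1]
      character_of_nonzero_on_principal[OF lin2 one(2) nz2] by auto
  have "\<psi>\<^sub>1 a = \<psi>\<^sub>2 a" for a
  proof (rule ccontr)
    assume "\<psi>\<^sub>1 a \<noteq> \<psi>\<^sub>2 a"
    then obtain b where "b \<in> principal" "\<psi>\<^sub>1 b = \<i>" "\<psi>\<^sub>2 b = 1"
      using characters_separated_on_principal[OF lin1 lin2 one mult] by blast
    \<comment> \<open>\<open>\<phi> b\<close> takes its real part from \<i> and its imaginary part
      from 1, so it is 0.\<close>
    then show False
      using nz[of b] by (simp add: \<phi>_eq complex_eq_iff)
  qed
  then have "\<phi> = \<psi>\<^sub>1"
    by (intro ext) (simp add: \<phi>_eq complex_eq_iff)
  then show ?thesis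
    using lin1 mult(1) by simp
qed

end

theorem lemma3p14:
  fixes scaleC :: "complex \<Rightarrow> 'a::banach \<Rightarrow> 'a"
    and jprod :: "'a \<Rightarrow> 'a \<Rightarrow> 'a"
    and unit :: 'a
    and \<phi> :: "'a \<Rightarrow> complex"
  assumes "complex_unital_jordan_banach_algebra scaleC jprod unit"
    and "linear \<phi>"
    and "\<phi> \<noteq> (\<lambda>a. 0)"
    and "\<And>a. \<phi> a \<in> exponential_spectrum scaleC jprod unit a"
  shows "Vector_Spaces.linear scaleC (*) \<phi> \<and>
    (\<forall>a b. \<phi> (jprod a b) = \<phi> a * \<phi> b)"
proof -
  interpret complex_unital_jordan_banach_algebra scaleC jprod unit
    by fact
  show ?thesis
    by (rule character_of_exponential_spectrum) (use assms in auto)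
qed

end
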